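(* Let $n\ge 4$ be an integer. Under the disjointness criterion, the geometric pseudo-Grundy index of the complete graph satisfies $$\gamma'_g(K_n)\ge \frac{n^2}{8}-\Theta(n).$$
   Context: A geometric graph of a graph $G$ is a drawing of $G$ in the plane in which the vertices are points in general position (no three collinear) and every edge is the straight-line segment joining its endpoints. Two distinct edges intersect if they share an endpoint or cross (meet at a point interior to both segments); they are disjoint if they do not intersect. Disjointness criterion: two edges are adjacent if and only if they are disjoint. A pseudo-Grundy $k$-coloring of a geometric graph $\mathsf{G}$ is an assignment of the colors $1,\dots,k$ to all the edges (not necessarily proper), with every color used, such that for every pair of colors $i<j$, every edge of color $j$ is adjacent to at least one edge of color $i$. The pseudo-Grundy index $\gamma'(\mathsf{G})$ is the largest $k$ for which $\mathsf{G}$ has a pseudo-Grundy $k$-coloring. The geometric pseudo-Grundy index of a graph $G$ is $\gamma'_g(G)=\min\{\gamma'(\mathsf{G}) : \mathsf{G}\text{ is a geometric graph of } G\}$. The term $-\Theta(n)$ in the lower bound denotes an error term that is linear in $n$: there is a constant $C>0$ such that $\gamma'_g(K_n)\ge \frac{n^2}{8}-Cn$. *)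

theory Defs
  imports "HOL-Analysis.Analysis"
begin

text \<open>A finite simple graph is given by a vertex set \<open>V\<close> and a set \<open>E\<close> of two-element subsets of \<open>V\<close>.
  A geometric graph of it is determined by the placement \<open>p\<close> of the vertices, since the edge \<open>{u, v}\<close>
  is drawn as the straight segment from \<open>p u\<close> to \<open>p v\<close>.\<close>

definition complete_edges :: "'a set \<Rightarrow> 'a set set" where
  "complete_edges V = {e. e \<subseteq> V \<and> card e = 2}"

definition general_position :: "'a set \<Rightarrow> ('a \<Rightarrow> real^2) \<Rightarrow> bool" where
  "general_position V p \<longleftrightarrow> inj_on p V \<and>
     (\<forall>u\<in>V. \<forall>v\<in>V. \<forall>w\<in>V. u \<noteq> v \<and> v \<noteq> w \<and> u \<noteq> w \<longrightarrow> \<not> collinear {p u, p v, p w})"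

definition crossing :: "('a \<Rightarrow> real^2) \<Rightarrow> 'a set \<Rightarrow> 'a set \<Rightarrow> bool" where
  "crossing p e f \<longleftrightarrow> (\<exists>a b c d. e = {a, b} \<and> f = {c, d} \<and>
     open_segment (p a) (p b) \<inter> open_segment (p c) (p d) \<noteq> {})"

text \<open>An edge shares an endpoint with itself, so disjoint edges are automatically distinct.\<close>

definition disjoint_edges :: "('a \<Rightarrow> real^2) \<Rightarrow> 'a set \<Rightarrow> 'a set \<Rightarrow> bool" where
  "disjoint_edges p e f \<longleftrightarrow> \<not> (e \<inter> f \<noteq> {} \<or> crossing p e f)"

definition pseudo_Grundy_coloring ::
  "'a set set \<Rightarrow> ('a \<Rightarrow> real^2) \<Rightarrow> nat \<Rightarrow> ('a set \<Rightarrow> nat) \<Rightarrow> bool" where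
  "pseudo_Grundy_coloring E p k c \<longleftrightarrow> c ` E = {1..k} \<and>
     (\<forall>i\<in>{1..k}. \<forall>j\<in>{1..k}. i < j \<longrightarrow>
        (\<forall>e\<in>E. c e = j \<longrightarrow> (\<exists>f\<in>E. c f = i \<and> disjoint_edges p e f)))"

definition pseudo_Grundy_index :: "'a set set \<Rightarrow> ('a \<Rightarrow> real^2) \<Rightarrow> nat" where
  "pseudo_Grundy_index E p = Max {k. \<exists>c. pseudo_Grundy_coloring E p k c}"

definition geometric_pseudo_Grundy_index :: "'a set \<Rightarrow> 'a set set \<Rightarrow> nat" where
  "geometric_pseudo_Grundy_index V E = Inf {pseudo_Grundy_index E p | p. general_position V p}"

text \<open>The maximum and the minimum above are taken over nonempty sets, the former over a finite one.\<close>

lemma finite_pseudo_Grundy_colorings: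
  assumes "finite E"
  shows "finite {k. \<exists>c. pseudo_Grundy_coloring E p k c}"
proof (rule finite_subset)
  show "{k. \<exists>c. pseudo_Grundy_coloring E p k c} \<subseteq> {..card E}"
  proof
    fix k assume "k \<in> {k. \<exists>c. pseudo_Grundy_coloring E p k c}"
    then obtain c where "c ` E = {1..k}" by (auto simp: pseudo_Grundy_coloring_def)
    then show "k \<in> {..card E}" using card_image_le[OF assms, of c] by simp
  qed
qed simp

lemma pseudo_Grundy_colorings_nonempty: "{k. \<exists>c. pseudo_Grundy_coloring E p k c} \<noteq> {}"
proof (cases "E = {}")
  case True
  then have "pseudo_Grundy_coloring E p 0 (\<lambda>_. 1)" by (simp add: pseudo_Grundy_coloring_def)
  then show ?thesis by blast
next
  case False
  then have "pseudo_Grundy_coloring E p 1 (\<lambda>_. 1)" by (auto simp: pseudo_Grundy_coloring_def)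
  then show ?thesis by blast
qed

lemma general_position_exists: "\<exists>p. general_position (V :: nat set) p"
proof -
  define p :: "nat \<Rightarrow> real^2" where "p = (\<lambda>i. vector [real i, (real i)^2])"
  have inj: "inj_on p V"
    by (rule inj_onI) (simp add: p_def vec_eq_iff forall_2)
  have "\<not> collinear {p u, p v, p w}" if d: "u \<noteq> v" "v \<noteq> w" "u \<noteq> w" for u v w
  proof
    assume "collinear {p u, p v, p w}"
    then obtain q where "\<And>x y. \<lbrakk>x \<in> {p u, p v, p w}; y \<in> {p u, p v, p w}\<rbrakk> \<Longrightarrow> \<exists>t. x - y = t *\<^sub>R q"
      unfolding collinear_def by blast
    then obtain s t where s: "p v - p u = s *\<^sub>R q" and t: "p w - p u = t *\<^sub>R q"
      by (meson insertI1 insertI2)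
    have s1: "real v - real u = s * q$1" "(real v)^2 - (real u)^2 = s * q$2"
      using s by (simp_all add: p_def vec_eq_iff forall_2)
    have t1: "real w - real u = t * q$1" "(real w)^2 - (real u)^2 = t * q$2"
      using t by (simp_all add: p_def vec_eq_iff forall_2)
    have "(real v - real u) * ((real w)^2 - (real u)^2) = (real w - real u) * ((real v)^2 - (real u)^2)"
      unfolding s1 t1 by simp
    then have "(real v - real u) * (real w - real u) * (real w - real v) = 0"
      by (simp add: power2_eq_square algebra_simps)
    then show False using d by simp
  qed
  then show ?thesis using inj by (auto simp: general_position_def)
qed

end

theory Submission
  imports Defs
begin

text \<open>Cut the drawing into two halves by a line. An edge inside one half and an edge inside the other
  lie on different sides of the line, so they are disjoint
  (\<open>disjoint_edges_if_separated\<close>). Each half spans at least \<open>\<lfloor>n/2\<rfloor> choose 2 = n\<^sup>2/8 - O(n)\<close>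
  edges, and this number is the number of colours: every colour class receives one edge from each
  half. An edge of one class lies in one of the halves and is disjoint from the edge that any other
  class has in the opposite half. All edges left over receive colour 1. This is harmless, because the
  condition constrains an edge only relative to smaller colours, and because enlarging a class makes
  it easier to find a disjoint edge in it (\<open>pseudo_Grundy_coloring_if_cross_disjoint\<close>).

  The direction of the line is chosen so that the linear functional \<open>x\<^sub>1 + t x\<^sub>2\<close> takes different
  values at the vertices; the left half then consists of the vertices with the smallest values
  (\<open>exists_injective_functional\<close>, \<open>exists_initial_subset\<close>).\<close>

text \<open>Two distinct points with the same value determine \<open>t\<close>, so a finite set of points excludes only
  finitely many \<open>t\<close>.\<close>

lemma exists_injective_functional:
  fixes S :: "(real^2) set"
  assumes "finite S"
  shows "\<exists>t. inj_on (\<lambda>x. x$1 + t * x$2) S"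
proof -
  let ?bad = "(\<lambda>(x, y). (y$1 - x$1) / (x$2 - y$2)) ` (S \<times> S)"
  have "finite ?bad" using assms by simp
  then obtain t where t: "t \<notin> ?bad"
    using ex_new_if_finite infinite_UNIV_char_0 by blast
  have "x = y" if xy: "x \<in> S" "y \<in> S" and eq: "x$1 + t * x$2 = y$1 + t * y$2" for x y
  proof (cases "x$2 = y$2")
    case True
    then show ?thesis using eq by (simp add: vec_eq_iff forall_2)
  next
    case False
    then have "t = (y$1 - x$1) / (x$2 - y$2)"
      using eq by (simp add: field_simps)
    then have "t \<in> ?bad" using xy by force
    then show ?thesis using t by blast
  qed
  then show ?thesis by (blast intro: inj_onI)
qed

lemma exists_initial_subset:
  fixes \<phi> :: "'a \<Rightarrow> 'b::linorder"
  assumes "finite A" "inj_on \<phi> A" "m \<le> card A"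
  shows "\<exists>B\<subseteq>A. card B = m \<and> (\<forall>b\<in>B. \<forall>a\<in>A - B. \<phi> b < \<phi> a)"
  using assms(3)
proof (induction m)
  case 0
  show ?case by (rule exI[of _ "{}"]) simp
next
  case (Suc m)
  then obtain B where B: "B \<subseteq> A" "card B = m" "\<forall>b\<in>B. \<forall>a\<in>A - B. \<phi> b < \<phi> a" by auto
  have fin: "finite B" "finite (A - B)" using assms(1) B(1) finite_subset by auto
  have "A - B \<noteq> {}" using B(1,2) Suc.prems by auto
  then obtain x where x: "x \<in> A - B" "\<forall>a\<in>A - B. \<phi> x \<le> \<phi> a"
    using arg_min_if_finite(1)[OF fin(2)] arg_min_least[OF fin(2)] by blast
  have "\<phi> x < \<phi> a" if "a \<in> A - insert x B" for a
  proof -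
    have "\<phi> x \<noteq> \<phi> a" using inj_onD[OF assms(2), of x a] x(1) that by blast
    then show ?thesis using x(2) that by (simp add: order_less_le)
  qed
  then have "\<forall>b\<in>insert x B. \<forall>a\<in>A - insert x B. \<phi> b < \<phi> a" using B(3) by blast
  moreover have "insert x B \<subseteq> A" "card (insert x B) = Suc m" using x(1) B(1,2) fin by auto
  ultimately show ?case by blast
qed

lemma crossing_sym: "crossing p e f \<Longrightarrow> crossing p f e"
  unfolding crossing_def by (metis Int_commute)

lemma disjoint_edges_sym: "disjoint_edges p e f \<Longrightarrow> disjoint_edges p f e"
  unfolding disjoint_edges_def using crossing_sym by blast

text \<open>A linear functional on a segment is bounded by its values at the endpoints.\<close>

lemma disjoint_edges_if_separated:
  fixes \<phi> :: "real^2 \<Rightarrow> real"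
  assumes lin: "linear \<phi>" and sep: "\<And>u v. u \<in> e \<Longrightarrow> v \<in> f \<Longrightarrow> \<phi> (p u) < \<phi> (p v)"
  shows "disjoint_edges p e f"
proof -
  have seg: "\<phi> z \<le> max (\<phi> a) (\<phi> b)" "min (\<phi> a) (\<phi> b) \<le> \<phi> z"
    if z: "z \<in> open_segment a b" for a b z
  proof -
    have "\<phi> z \<in> closed_segment (\<phi> a) (\<phi> b)"
      using z closed_segment_linear_image[OF lin] segment_open_subset_closed by blast
    then show "\<phi> z \<le> max (\<phi> a) (\<phi> b)" "min (\<phi> a) (\<phi> b) \<le> \<phi> z"
      by (auto simp: closed_segment_eq_real_ivl split: if_splits)
  qed
  have "\<not> crossing p e f"
  proof
    assume "crossing p e f"
    then obtain a b c d z where ends: "e = {a, b}" "f = {c, d}"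
      and z: "z \<in> open_segment (p a) (p b)" "z \<in> open_segment (p c) (p d)"
      unfolding crossing_def by blast
    have "max (\<phi> (p a)) (\<phi> (p b)) < min (\<phi> (p c)) (\<phi> (p d))"
      using sep ends by simp
    then show False using seg(1)[OF z(1)] seg(2)[OF z(2)] by linarith
  qed
  moreover have "e \<inter> f = {}" using sep by blast
  ultimately show ?thesis by (simp add: disjoint_edges_def)
qed

text \<open>Enumerating \<open>A\<close> and \<open>B\<close> by the colours makes every colour class meet both sets, so an edge of
  \<open>A\<close> finds its disjoint edge in the part of the other class that lies in \<open>B\<close>, and conversely.\<close>

lemma pseudo_Grundy_coloring_if_cross_disjoint:
  assumes sub: "A \<subseteq> E" "B \<subseteq> E" and fin: "finite A" "finite B"
    and card: "card A = k" "card B = k" "k \<ge> 1"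
    and disj: "\<And>a b. a \<in> A \<Longrightarrow> b \<in> B \<Longrightarrow> disjoint_edges p a b" and AB: "A \<inter> B = {}"
  shows "\<exists>c. pseudo_Grundy_coloring E p k c"
proof -
  obtain g h where g: "bij_betw g A {1..k}" and h: "bij_betw h B {1..k}"
    using finite_same_card_bij[OF fin(1), of "{1..k}"] finite_same_card_bij[OF fin(2), of "{1..k}"] card
    by auto
  define c where "c e = (if e \<in> A then g e else if e \<in> B then h e else 1)" for e
  have in_A: "\<exists>a\<in>A. c a = i" if "i \<in> {1..k}" for i
  proof -
    have "i \<in> g ` A" using that bij_betw_imp_surj_on[OF g] by simp
    then show ?thesis by (auto simp: c_def)
  qed
  have in_B: "\<exists>b\<in>B. c b = i" if "i \<in> {1..k}" for i
  proof -
    have "i \<in> h ` B" using that bij_betw_imp_surj_on[OF h] by simp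
    then obtain b where b: "b \<in> B" "h b = i" by blast
    moreover have "b \<notin> A" using b(1) AB by blast
    ultimately show ?thesis by (auto simp: c_def)
  qed
  have "c e \<in> {1..k}" for e
    using bij_betwE[OF g] bij_betwE[OF h] card(3) by (auto simp: c_def)
  then have "c ` E = {1..k}" using in_A sub(1) by (intro equalityI subsetI) blast+
  moreover have "\<exists>f\<in>E. c f = i \<and> disjoint_edges p e f"
    if i: "i \<in> {1..k}" and less: "i < c e" for i e
  proof -
    \<comment> \<open>An edge outside both families has colour 1, and no colour is smaller.\<close>
    have "e \<in> A \<or> e \<in> B" using i less by (auto simp: c_def split: if_splits)
    then show ?thesis
    proof
      assume "e \<in> A"
      then show ?thesis using in_B[OF i] disj sub(2) by blast
    next
      assume "e \<in> B"
      then show ?thesis using in_A[OF i] disj disjoint_edges_sym sub(1) by blast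
    qed
  qed
  ultimately have "pseudo_Grundy_coloring E p k c" by (auto simp: pseudo_Grundy_coloring_def)
  then show ?thesis by blast
qed

lemma finite_complete_edges: "finite V \<Longrightarrow> finite (complete_edges V)"
  by (simp add: complete_edges_def)

lemma card_complete_edges: "finite V \<Longrightarrow> card (complete_edges V) = card V choose 2"
  by (simp add: complete_edges_def n_subsets)

lemma pseudo_Grundy_index_complete_ge:
  fixes p :: "'a \<Rightarrow> real^2"
  assumes fin: "finite V" and inj: "inj_on p V" and m: "2 \<le> m" "2 * m \<le> card V"
  shows "m choose 2 \<le> pseudo_Grundy_index (complete_edges V) p"
proof -
  obtain t where t: "inj_on (\<lambda>x. x$1 + t * x$2) (p ` V)"
    using exists_injective_functional fin by blast
  define \<phi> :: "real^2 \<Rightarrow> real" where "\<phi> = (\<lambda>x. x$1 + t * x$2)"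
  have lin: "linear \<phi>" by (rule linearI) (simp_all add: \<phi>_def algebra_simps)
  have inj_\<phi>: "inj_on (\<lambda>v. \<phi> (p v)) V"
    using comp_inj_on[OF inj t] by (simp add: \<phi>_def comp_def)
  obtain L where L: "L \<subseteq> V" "card L = m" "\<forall>u\<in>L. \<forall>v\<in>V - L. \<phi> (p u) < \<phi> (p v)"
    using exists_initial_subset[OF fin inj_\<phi>, of m] m by auto
  have "m \<le> card (V - L)" using L m fin by (simp add: card_Diff_subset finite_subset)
  then obtain R where R: "R \<subseteq> V - L" "card R = m"
    using obtain_subset_with_card_n by metis
  have finLR: "finite L" "finite R" using L R fin by (meson Diff_subset finite_subset)+
  have disj: "disjoint_edges p e f" if "e \<in> complete_edges L" "f \<in> complete_edges R" for e f
  proof (rule disjoint_edges_if_separated[OF lin])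
    fix u v assume "u \<in> e" "v \<in> f"
    then have "u \<in> L" "v \<in> V - L" using that R(1) by (auto simp: complete_edges_def)
    then show "\<phi> (p u) < \<phi> (p v)" using L(3) by blast
  qed
  \<comment> \<open>An edge in both families would be disjoint from itself.\<close>
  have AB: "complete_edges L \<inter> complete_edges R = {}"
  proof -
    have False if "e \<in> complete_edges L" "e \<in> complete_edges R" for e
    proof -
      have "e = {}" using disj[OF that] by (simp add: disjoint_edges_def)
      then show False using that by (simp add: complete_edges_def)
    qed
    then show ?thesis by blast
  qed
  have sub: "complete_edges L \<subseteq> complete_edges V" "complete_edges R \<subseteq> complete_edges V"
    using L(1) R(1) by (auto simp: complete_edges_def)
  have "\<exists>c. pseudo_Grundy_coloring (complete_edges V) p (m choose 2) c"
    using m(1) finLR L(2) R(2)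
    by (intro pseudo_Grundy_coloring_if_cross_disjoint[OF sub _ _ _ _ _ disj AB])
      (auto simp: finite_complete_edges card_complete_edges Suc_le_eq)
  then show ?thesis
    unfolding pseudo_Grundy_index_def
    by (intro Max_ge finite_pseudo_Grundy_colorings finite_complete_edges fin) simp
qed

theorem theorem10:
  "\<exists>C::real. C > 0 \<and> (\<forall>n::nat. n \<ge> 4 \<longrightarrow>
     real (geometric_pseudo_Grundy_index {..<n} (complete_edges {..<n})) \<ge> (real n)^2 / 8 - C * real n)"
proof (intro exI[of _ "1/2"] conjI allI impI)
  fix n :: nat assume n: "4 \<le> n"
  define m where "m = n div 2"
  have m: "2 \<le> m" "2 * m \<le> n" "n \<le> 2 * m + 1" using n by (auto simp: m_def)
  have "m choose 2 \<le> geometric_pseudo_Grundy_index {..<n} (complete_edges {..<n})"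
    unfolding geometric_pseudo_Grundy_index_def
  proof (rule cInf_greatest)
    show "{pseudo_Grundy_index (complete_edges {..<n}) p | p. general_position {..<n} p} \<noteq> {}"
      using general_position_exists by blast
  next
    fix k assume "k \<in> {pseudo_Grundy_index (complete_edges {..<n}) p | p. general_position {..<n} p}"
    then show "m choose 2 \<le> k"
      using m pseudo_Grundy_index_complete_ge[of "{..<n}" _ m] by (auto simp: general_position_def)
  qed
  moreover have "(real n)^2 / 8 - 1/2 * real n \<le> real (m choose 2)"
  proof -
    have "real (m choose 2) = real m * (real m - 1) / 2"
      using m(1) by (simp add: choose_two real_of_nat_div of_nat_diff)
    \<comment> \<open>From \<open>n - 1 \<le> 2m\<close> this is at least \<open>(n - 1)(n - 3)/8\<close>.\<close>
    moreover have "(real n - 1) * (real n - 3) \<le> (2 * real m) * (2 * real m - 2)"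
      using m n by (intro mult_mono) auto
    ultimately show ?thesis by (simp add: power2_eq_square algebra_simps)
  qed
  ultimately show "(real n)^2 / 8 - 1/2 * real n
      \<le> real (geometric_pseudo_Grundy_index {..<n} (complete_edges {..<n}))"
    by linarith
qed simp

end
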